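(* Let $R=\mathbb F_{q_1}\times\cdots\times\mathbb F_{q_t}$ be a product of $t\ge 3$ finite fields of arbitrary orders. Then $\gamma(\mathcal D(R))=2$.
   Context: $Z(R)$ is the set of zero-divisors of $R$ and $Z(R)^*=Z(R)\setminus\{0\}$. $\Gamma(R)$ is the simple graph with vertex set $Z(R)^*$, with distinct $x,y$ adjacent iff $xy=0$. $W\Gamma(R)$ is the simple graph with vertex set $Z(R)^*$, with distinct $x,y$ adjacent iff there exist nonzero $r\in\operatorname{Ann}(x)$ and nonzero $s\in\operatorname{Ann}(y)$ with $rs=0$. The weak zero-divisor difference graph $\mathcal D(R)$ is the graph on $Z(R)^*$ with edge set $E(W\Gamma(R))\setminus E(\Gamma(R))$, with resulting isolated vertices deleted (for $t\ge3$ no vertex is in fact isolated, so the vertex set is $Z(R)^*$). The domination number $\gamma(G)$ is the minimum size of a set $S\subseteq V(G)$ such that every vertex of $G$ lies in $S$ or is adjacent to a vertex of $S$. *)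

theory Defs
  imports "HOL-Algebra.Chinese_Remainder" "Graph_Theory.Pair_Digraph"
begin

text \<open>
  All ring notions below are meant for commutative rings, so left and right versions agree.
  Zero itself counts as a zero-divisor (of a nonzero ring).
\<close>

definition zero_divisors :: "('a, 'm) ring_scheme \<Rightarrow> 'a set"
  where "zero_divisors R =
    {x \<in> carrier R. \<exists>y \<in> carrier R. y \<noteq> \<zero>\<^bsub>R\<^esub> \<and> x \<otimes>\<^bsub>R\<^esub> y = \<zero>\<^bsub>R\<^esub>}"

definition nonzero_zero_divisors :: "('a, 'm) ring_scheme \<Rightarrow> 'a set"
  where "nonzero_zero_divisors R = zero_divisors R - {\<zero>\<^bsub>R\<^esub>}"

definition annihilator :: "('a, 'm) ring_scheme \<Rightarrow> 'a \<Rightarrow> 'a set"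
  where "annihilator R x = {r \<in> carrier R. r \<otimes>\<^bsub>R\<^esub> x = \<zero>\<^bsub>R\<^esub>}"

text \<open>
  A finite simple graph is a \<open>pair_graph\<close>: the edge \<open>{x, y}\<close> is represented
  by the two arcs \<open>(x, y)\<close> and \<open>(y, x)\<close>.  For finite commutative rings the lemmas
  below show that the graphs defined here are of this kind.
\<close>

definition zero_divisor_graph :: "('a, 'm) ring_scheme \<Rightarrow> 'a pair_pre_digraph"
  where "zero_divisor_graph R =
    \<lparr> pverts = nonzero_zero_divisors R,
      parcs = {(x, y). x \<in> nonzero_zero_divisors R \<and> y \<in> nonzero_zero_divisors R \<and>
                 x \<noteq> y \<and> x \<otimes>\<^bsub>R\<^esub> y = \<zero>\<^bsub>R\<^esub>} \<rparr>"

definition weak_zero_divisor_graph :: "('a, 'm) ring_scheme \<Rightarrow> 'a pair_pre_digraph"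
  where "weak_zero_divisor_graph R =
    \<lparr> pverts = nonzero_zero_divisors R,
      parcs = {(x, y). x \<in> nonzero_zero_divisors R \<and> y \<in> nonzero_zero_divisors R \<and>
                 x \<noteq> y \<and>
                 (\<exists>r \<in> annihilator R x - {\<zero>\<^bsub>R\<^esub>}. \<exists>s \<in> annihilator R y - {\<zero>\<^bsub>R\<^esub>}.
                    r \<otimes>\<^bsub>R\<^esub> s = \<zero>\<^bsub>R\<^esub>)} \<rparr>"

definition delete_isolated :: "'v pair_pre_digraph \<Rightarrow> 'v pair_pre_digraph"
  where "delete_isolated G =
    \<lparr> pverts = {v \<in> pverts G. \<exists>w \<in> pverts G. (v, w) \<in> parcs G}, parcs = parcs G \<rparr>"

definition weak_zero_divisor_difference_graph :: "('a, 'm) ring_scheme \<Rightarrow> 'a pair_pre_digraph"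
  where "weak_zero_divisor_difference_graph R =
    delete_isolated
      \<lparr> pverts = nonzero_zero_divisors R,
        parcs = parcs (weak_zero_divisor_graph R) - parcs (zero_divisor_graph R) \<rparr>"

definition dominating_set :: "'v pair_pre_digraph \<Rightarrow> 'v set \<Rightarrow> bool"
  where "dominating_set G S \<longleftrightarrow>
    S \<subseteq> pverts G \<and> (\<forall>v \<in> pverts G. v \<in> S \<or> (\<exists>s \<in> S. (v, s) \<in> parcs G))"

text \<open>
  The finiteness condition is needed because infinite sets have \<open>card\<close> zero; every
  finite graph has a finite dominating set, namely its vertex set.
\<close>

definition domination_number :: "'v pair_pre_digraph \<Rightarrow> nat"
  where "domination_number G = (LEAST n. \<exists>S. dominating_set G S \<and> finite S \<and> card S = n)"

lemma pair_graphI: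
  assumes "finite V" "E \<subseteq> V \<times> V" "irrefl E" "sym E"
  shows "pair_graph \<lparr> pverts = V, parcs = E \<rparr>"
proof -
  have "finite E"
    using assms(1,2) by (meson finite_SigmaI finite_subset)
  with assms show ?thesis
    by unfold_locales (auto simp: symmetric_def irrefl_def)
qed

lemma (in cring) pair_graph_zero_divisor_graph:
  assumes "finite (carrier R)"
  shows "pair_graph (zero_divisor_graph R)"
  unfolding zero_divisor_graph_def
proof (rule pair_graphI)
  have V: "nonzero_zero_divisors R \<subseteq> carrier R"
    unfolding nonzero_zero_divisors_def zero_divisors_def by blast
  then show "finite (nonzero_zero_divisors R)"
    using assms finite_subset by blast
  show "sym {(x, y). x \<in> nonzero_zero_divisors R \<and> y \<in> nonzero_zero_divisors R \<and>
               x \<noteq> y \<and> x \<otimes> y = \<zero>}"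
  proof (rule symI, clarify, intro conjI)
    fix x y assume "x \<in> nonzero_zero_divisors R" "y \<in> nonzero_zero_divisors R" "x \<otimes> y = \<zero>"
    then show "y \<otimes> x = \<zero>"
      using V m_comm[of x y] by (metis subsetD)
  qed blast+
qed (auto intro: irreflI)

lemma (in cring) pair_graph_weak_zero_divisor_graph:
  assumes "finite (carrier R)"
  shows "pair_graph (weak_zero_divisor_graph R)"
  unfolding weak_zero_divisor_graph_def
proof (rule pair_graphI)
  have "nonzero_zero_divisors R \<subseteq> carrier R"
    unfolding nonzero_zero_divisors_def zero_divisors_def by blast
  then show "finite (nonzero_zero_divisors R)"
    using assms finite_subset by blast
  show "sym {(x, y). x \<in> nonzero_zero_divisors R \<and> y \<in> nonzero_zero_divisors R \<and> x \<noteq> y \<and>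
               (\<exists>r \<in> annihilator R x - {\<zero>}. \<exists>s \<in> annihilator R y - {\<zero>}. r \<otimes> s = \<zero>)}"
  proof (rule symI, clarify, intro conjI)
    fix x y r s
    assume rs: "r \<in> annihilator R x" "r \<noteq> \<zero>" "s \<in> annihilator R y" "s \<noteq> \<zero>" "r \<otimes> s = \<zero>"
    then have "s \<otimes> r = \<zero>"
      using m_comm[of r s] by (simp add: annihilator_def)
    with rs show "\<exists>r \<in> annihilator R y - {\<zero>}. \<exists>s \<in> annihilator R x - {\<zero>}. r \<otimes> s = \<zero>"
      by blast
  qed blast+
qed (auto intro: irreflI)

lemma (in cring) pair_graph_weak_zero_divisor_difference_graph:
  assumes "finite (carrier R)"
  shows "pair_graph (weak_zero_divisor_difference_graph R)"
proof -
  interpret G: pair_graph "zero_divisor_graph R"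
    by (rule pair_graph_zero_divisor_graph[OF assms])
  interpret W: pair_graph "weak_zero_divisor_graph R"
    by (rule pair_graph_weak_zero_divisor_graph[OF assms])
  define V where "V = nonzero_zero_divisors R"
  define E where "E = parcs (weak_zero_divisor_graph R) - parcs (zero_divisor_graph R)"
  have V: "V = pverts (weak_zero_divisor_graph R)"
    by (simp add: V_def weak_zero_divisor_graph_def)
  have fin: "finite V"
    unfolding V by (rule W.pair_finite_verts)
  have sub: "E \<subseteq> V \<times> V"
    unfolding V E_def by (auto dest: W.in_arcsD1 W.in_arcsD2)
  have "irrefl E"
    unfolding E_def by (rule irreflI) (use W.pair_no_loops in fastforce)
  moreover have "sym E"
    using G.pair_sym_arcs W.pair_sym_arcs
    unfolding symmetric_def with_proj_simps E_def sym_def by blast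
  moreover have "finite {v \<in> V. \<exists>w \<in> V. (v, w) \<in> E}"
    using fin by simp
  moreover have "E \<subseteq> {v \<in> V. \<exists>w \<in> V. (v, w) \<in> E} \<times> {v \<in> V. \<exists>w \<in> V. (v, w) \<in> E}"
    using sub \<open>sym E\<close> unfolding sym_def by blast
  ultimately show ?thesis
    unfolding weak_zero_divisor_difference_graph_def delete_isolated_def
      V_def[symmetric] E_def[symmetric] pair_pre_digraph.simps
    by (intro pair_graphI)
qed

end

theory Submission
  imports Defs
begin

text \<open>
  Write \<open>Z x\<close> for the set of coordinates at which \<open>x\<close> vanishes. Distinct vertices \<open>x\<close>, \<open>y\<close> are
  adjacent in the difference graph iff \<open>Z x \<union> Z y\<close> has at least two elements (so that they have
  nonzero annihilators with disjoint supports) but is not the whole index set (so that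
  \<open>x y\<close> is nonzero). Two vertices vanishing exactly at \<open>0\<close> and exactly at \<open>1\<close> therefore dominate
  everything once there are three coordinates. A single vertex \<open>u\<close> never suffices: a vertex that
  vanishes exactly where \<open>u\<close> does not is annihilated by \<open>u\<close>.
\<close>

section \<open>Coordinatewise arithmetic in list products\<close>

lemma RDirProd_list_mult_Cons:
  assumes "a # as \<in> carrier (RDirProd_list (R # Rs))" "b # bs \<in> carrier (RDirProd_list (R # Rs))"
  shows "(a # as) \<otimes>\<^bsub>RDirProd_list (R # Rs)\<^esub> (b # bs) =
    (a \<otimes>\<^bsub>R\<^esub> b) # (as \<otimes>\<^bsub>RDirProd_list Rs\<^esub> bs)"
proof -
  have "(a, as) \<in> carrier (RDirProd R (RDirProd_list Rs))"
    "(b, bs) \<in> carrier (RDirProd R (RDirProd_list Rs))"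
    using assms by (auto simp: RDirProd_carrier RDirProd_list_carrier)
  from ring_hom_mult[OF RDirProd_list_hom1 this] show ?thesis
    by (simp add: RDirProd_def DirProd_def monoid.defs)
qed

lemma RDirProd_list_mult_eq_map:
  assumes "xs \<in> carrier (RDirProd_list Rs)" "ys \<in> carrier (RDirProd_list Rs)"
  shows "xs \<otimes>\<^bsub>RDirProd_list Rs\<^esub> ys = map (\<lambda>i. xs ! i \<otimes>\<^bsub>Rs ! i\<^esub> ys ! i) [0..<length Rs]"
  using assms
proof (induction Rs arbitrary: xs ys)
  case Nil
  then show ?case by (simp add: monoid.defs)
next
  case (Cons R Rs)
  then obtain a as b bs where "xs = a # as" "ys = b # bs"
    "as \<in> carrier (RDirProd_list Rs)" "bs \<in> carrier (RDirProd_list Rs)"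
    by (auto simp: RDirProd_list_carrier)
  with Cons show ?case
    by (simp add: RDirProd_list_mult_Cons upt_conv_Cons map_Suc_upt[symmetric] del: upt_Suc)
qed

lemma RDirProd_list_zero_eq_map: "\<zero>\<^bsub>RDirProd_list Rs\<^esub> = map zero Rs"
  unfolding RDirProd_list_zero by (induction Rs) auto

section \<open>Products of domains, described by vanishing coordinates\<close>

locale domain_product =
  fixes Fs :: "('a, 'm) ring_scheme list"
  assumes domain_nth: "i < length Fs \<Longrightarrow> domain (Fs ! i)"
begin

abbreviation P :: "'a list ring"
  where "P \<equiv> RDirProd_list Fs"

definition vanishes :: "'a list \<Rightarrow> nat \<Rightarrow> bool"
  where "vanishes x i \<longleftrightarrow> x ! i = \<zero>\<^bsub>Fs ! i\<^esub>"

text \<open>The idempotent with support \<open>A\<close>. Indices beyond the list are ignored, so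
  complements such as \<open>- {i}\<close> are allowed; that one gives the element vanishing exactly
  at \<open>i\<close>.\<close>

definition idem :: "nat set \<Rightarrow> 'a list"
  where "idem A = map (\<lambda>i. if i \<in> A then \<one>\<^bsub>Fs ! i\<^esub> else \<zero>\<^bsub>Fs ! i\<^esub>) [0..<length Fs]"

lemma idem_carrier: "idem A \<in> carrier P"
proof (rule RDirProd_list_carrier_memI)
  fix i assume i: "i < length Fs"
  interpret F: domain "Fs ! i" by (rule domain_nth[OF i])
  show "idem A ! i \<in> carrier (Fs ! i)"
    using i by (simp add: idem_def)
qed (simp add: idem_def)

lemma vanishes_idem: "i < length Fs \<Longrightarrow> vanishes (idem A) i \<longleftrightarrow> i \<notin> A"
proof -
  assume i: "i < length Fs"
  interpret F: domain "Fs ! i" by (rule domain_nth[OF i])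
  show ?thesis
    using i by (simp add: idem_def vanishes_def)
qed

lemma eq_zero_iff:
  assumes "x \<in> carrier P"
  shows "x = \<zero>\<^bsub>P\<^esub> \<longleftrightarrow> (\<forall>i < length Fs. vanishes x i)"
  using RDirProd_list_carrier_mem(1)[OF assms]
  unfolding RDirProd_list_zero_eq_map vanishes_def by (subst list_eq_iff_nth_eq) simp

text \<open>Products are formed coordinatewise, and each factor is a domain, so a coordinate of the
  product is zero only if one of the two entries is.\<close>

lemma mult_eq_zero_iff:
  assumes "x \<in> carrier P" "y \<in> carrier P"
  shows "x \<otimes>\<^bsub>P\<^esub> y = \<zero>\<^bsub>P\<^esub> \<longleftrightarrow> (\<forall>i < length Fs. vanishes x i \<or> vanishes y i)"
proof -
  note x = RDirProd_list_carrier_mem[OF assms(1)] and y = RDirProd_list_carrier_mem[OF assms(2)]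
  have *: "x ! i \<otimes>\<^bsub>Fs ! i\<^esub> y ! i = \<zero>\<^bsub>Fs ! i\<^esub> \<longleftrightarrow> vanishes x i \<or> vanishes y i"
    if i: "i < length Fs" for i
    using domain.integral_iff[OF domain_nth[OF i] x(2)[OF i] y(2)[OF i]]
    by (simp add: vanishes_def)
  have "x \<otimes>\<^bsub>P\<^esub> y = \<zero>\<^bsub>P\<^esub> \<longleftrightarrow>
      (\<forall>i < length Fs. x ! i \<otimes>\<^bsub>Fs ! i\<^esub> y ! i = \<zero>\<^bsub>Fs ! i\<^esub>)"
    unfolding RDirProd_list_mult_eq_map[OF assms] RDirProd_list_zero_eq_map
    by (subst list_eq_iff_nth_eq) simp
  with * show ?thesis
    by blast
qed

text \<open>A zero of \<open>x\<close> at \<open>i\<close> makes \<open>idem {i}\<close> a nonzero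
  annihilator. Conversely, a nonzero \<open>y\<close> with \<open>x y = 0\<close> has a nonzero
  coordinate, and \<open>x\<close> must vanish there.\<close>

lemma nonzero_zero_divisors_iff:
  "x \<in> nonzero_zero_divisors P \<longleftrightarrow>
    x \<in> carrier P \<and> (\<exists>i < length Fs. vanishes x i) \<and> (\<exists>k < length Fs. \<not> vanishes x k)"
proof (cases "x \<in> carrier P")
  case True
  have "\<exists>y \<in> carrier P. y \<noteq> \<zero>\<^bsub>P\<^esub> \<and> x \<otimes>\<^bsub>P\<^esub> y = \<zero>\<^bsub>P\<^esub>"
    if "i < length Fs" "vanishes x i" for i
    using that True
    by (intro bexI[OF _ idem_carrier[of "{i}"]])
      (auto simp: eq_zero_iff mult_eq_zero_iff idem_carrier vanishes_idem)
  moreover have "\<exists>i < length Fs. vanishes x i"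
    if "y \<in> carrier P" "y \<noteq> \<zero>\<^bsub>P\<^esub>" "x \<otimes>\<^bsub>P\<^esub> y = \<zero>\<^bsub>P\<^esub>" for y
    using that True by (auto simp: eq_zero_iff mult_eq_zero_iff)
  ultimately show ?thesis
    using True unfolding nonzero_zero_divisors_def zero_divisors_def
    by (auto simp: eq_zero_iff)
next
  case False
  then show ?thesis
    unfolding nonzero_zero_divisors_def zero_divisors_def by blast
qed

section \<open>Adjacency in the difference graph\<close>

lemma idem_vertex:
  assumes "i < length Fs" "i \<notin> A" "k < length Fs" "k \<in> A"
  shows "idem A \<in> nonzero_zero_divisors P"
proof -
  have "vanishes (idem A) i" "\<not> vanishes (idem A) k"
    using assms by (simp_all add: vanishes_idem)
  with assms(1,3) show ?thesis
    unfolding nonzero_zero_divisors_iff using idem_carrier by blast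
qed

text \<open>The annihilators \<open>idem {i}\<close> and \<open>idem {j}\<close> have disjoint
  supports, which gives the weak adjacency; the common nonzero coordinate \<open>k\<close> keeps
  \<open>x y\<close> nonzero.\<close>

lemma difference_graph_arcI:
  assumes x: "x \<in> nonzero_zero_divisors P" and y: "y \<in> nonzero_zero_divisors P"
    and "x \<noteq> y"
    and i: "i < length Fs" "vanishes x i" and j: "j < length Fs" "vanishes y j" and "i \<noteq> j"
    and k: "k < length Fs" "\<not> vanishes x k" "\<not> vanishes y k"
  shows "(x, y) \<in> parcs (weak_zero_divisor_difference_graph P)"
proof -
  have xy: "x \<in> carrier P" "y \<in> carrier P"
    using x y unfolding nonzero_zero_divisors_iff by blast+
  have "idem {i} \<in> annihilator P x - {\<zero>\<^bsub>P\<^esub>}"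
    using xy i by (auto simp: annihilator_def idem_carrier mult_eq_zero_iff eq_zero_iff vanishes_idem)
  moreover have "idem {j} \<in> annihilator P y - {\<zero>\<^bsub>P\<^esub>}"
    using xy j by (auto simp: annihilator_def idem_carrier mult_eq_zero_iff eq_zero_iff vanishes_idem)
  moreover have "idem {i} \<otimes>\<^bsub>P\<^esub> idem {j} = \<zero>\<^bsub>P\<^esub>"
    using \<open>i \<noteq> j\<close> by (auto simp: idem_carrier mult_eq_zero_iff vanishes_idem)
  moreover have "x \<otimes>\<^bsub>P\<^esub> y \<noteq> \<zero>\<^bsub>P\<^esub>"
    using xy k by (auto simp: mult_eq_zero_iff)
  ultimately show ?thesis
    using x y \<open>x \<noteq> y\<close>
    by (auto simp: weak_zero_divisor_difference_graph_def delete_isolated_def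
        weak_zero_divisor_graph_def zero_divisor_graph_def)
qed

text \<open>An arc of the weak graph already joins distinct vertices, so its absence from the
  zero-divisor graph forces a nonzero product.\<close>

lemma difference_graph_arcD:
  assumes "(x, y) \<in> parcs (weak_zero_divisor_difference_graph P)"
  shows "x \<otimes>\<^bsub>P\<^esub> y \<noteq> \<zero>\<^bsub>P\<^esub>"
  using assms
  by (auto simp: weak_zero_divisor_difference_graph_def delete_isolated_def
      weak_zero_divisor_graph_def zero_divisor_graph_def)

lemma idem_Compl_singleton_vertex:
  assumes "length Fs \<ge> 2" "i < length Fs"
  shows "idem (- {i}) \<in> nonzero_zero_divisors P"
proof -
  \<comment> \<open>An index other than \<open>i\<close>, where the idempotent is nonzero.\<close>
  have "(if i = 0 then 1 else 0) < length Fs" "(if i = 0 then 1 else 0) \<noteq> i"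
    using assms by auto
  then show ?thesis
    using assms(2) by (blast intro: idem_vertex)
qed

lemma difference_graph_arc_to_idem:
  assumes n: "length Fs \<ge> 3" and v: "v \<in> nonzero_zero_divisors P"
  shows "\<exists>s \<in> {idem (- {0}), idem (- {1})}.
    (v, s) \<in> parcs (weak_zero_divisor_difference_graph P)"
proof -
  \<comment> \<open>A zero \<open>i\<close> and a nonzero coordinate \<open>k\<close> of
    \<open>v\<close>, both away from \<open>j\<close>, suffice; \<open>i\<close> also separates
    \<open>v\<close> from the idempotent.\<close>
  have arc: "(v, idem (- {j})) \<in> parcs (weak_zero_divisor_difference_graph P)"
    if "j < length Fs" "i < length Fs" "k < length Fs" "i \<noteq> j" "k \<noteq> j"
      "vanishes v i" "\<not> vanishes v k" for i j k
  proof (rule difference_graph_arcI[of _ _ i j k])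
    show "v \<noteq> idem (- {j})"
      using that by (auto simp: vanishes_idem)
  qed (use that v n in \<open>auto simp: vanishes_idem idem_Compl_singleton_vertex\<close>)
  obtain i k where ik: "i < length Fs" "vanishes v i" "k < length Fs" "\<not> vanishes v k"
    using v unfolding nonzero_zero_divisors_iff by blast
  \<comment> \<open>If \<open>i\<close> or \<open>k\<close> is 0, coordinate 2, distinct from both 0
    and 1, decides: either it replaces that index and \<open>j = 0\<close> works, or it pairs with
    coordinate 0 and \<open>j = 1\<close> works.\<close>
  consider "i \<noteq> 0" "k \<noteq> 0" | "i = 0" "vanishes v 2" | "i = 0" "\<not> vanishes v 2"
    | "k = 0" "vanishes v 2" | "k = 0" "\<not> vanishes v 2"
    by blast
  then show ?thesis
  proof cases
    case 1
    with arc[of 0 i k] ik n show ?thesis by force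
  next
    case 2
    with ik have "k \<noteq> 0" by metis
    with arc[of 0 2 k] 2 ik n show ?thesis by force
  next
    case 3
    with arc[of 1 0 2] ik n show ?thesis by force
  next
    case 4
    with arc[of 1 2 0] ik n show ?thesis by force
  next
    case 5
    with ik have "i \<noteq> 0" by metis
    with arc[of 0 i 2] 5 ik n show ?thesis by force
  qed
qed

text \<open>Every vertex, including the two idempotents themselves, has an arc to one of these
  idempotents, so none is isolated.\<close>

lemma pverts_difference_graph:
  assumes "length Fs \<ge> 3"
  shows "pverts (weak_zero_divisor_difference_graph P) = nonzero_zero_divisors P"
proof -
  have "idem (- {0}) \<in> nonzero_zero_divisors P" "idem (- {1}) \<in> nonzero_zero_divisors P"
    using assms by (auto intro!: idem_Compl_singleton_vertex)
  then show ?thesis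
    using difference_graph_arc_to_idem[OF assms]
    unfolding weak_zero_divisor_difference_graph_def delete_isolated_def by fastforce
qed

section \<open>Dominating sets\<close>

lemma dominating_set_idem:
  assumes "length Fs \<ge> 3"
  shows "dominating_set (weak_zero_divisor_difference_graph P) {idem (- {0}), idem (- {1})}"
proof -
  have "idem (- {0}) \<in> nonzero_zero_divisors P" "idem (- {1}) \<in> nonzero_zero_divisors P"
    using assms by (auto intro!: idem_Compl_singleton_vertex)
  then show ?thesis
    using difference_graph_arc_to_idem[OF assms]
    by (simp add: dominating_set_def pverts_difference_graph[OF assms])
qed

lemma not_dominating_singleton:
  assumes n: "length Fs \<ge> 3"
  shows "\<not> dominating_set (weak_zero_divisor_difference_graph P) {u}"
proof
  assume dom: "dominating_set (weak_zero_divisor_difference_graph P) {u}"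
  define v where "v = idem {i. vanishes u i}"
  have u: "u \<in> nonzero_zero_divisors P"
    using dom by (simp add: dominating_set_def pverts_difference_graph[OF n])
  then obtain i k where ik: "u \<in> carrier P" "i < length Fs" "vanishes u i"
    "k < length Fs" "\<not> vanishes u k"
    unfolding nonzero_zero_divisors_iff by blast
  \<comment> \<open>Passing from \<open>u\<close> to \<open>v\<close> swaps zero and nonzero
    coordinates, so \<open>i\<close> and \<open>k\<close> exchange roles.\<close>
  then have v: "v \<in> nonzero_zero_divisors P"
    unfolding v_def by (intro idem_vertex[of k _ i]) auto
  have "v \<noteq> u"
    using ik vanishes_idem[of i "{i. vanishes u i}"] unfolding v_def by auto
  then have "(v, u) \<in> parcs (weak_zero_divisor_difference_graph P)"
    using dom v by (auto simp: dominating_set_def pverts_difference_graph[OF n])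
  moreover have "v \<otimes>\<^bsub>P\<^esub> u = \<zero>\<^bsub>P\<^esub>"
    using mult_eq_zero_iff[OF idem_carrier ik(1)] by (simp add: v_def vanishes_idem)
  ultimately show False
    using difference_graph_arcD by blast
qed

lemma domination_number_difference_graph:
  assumes n: "length Fs \<ge> 3"
  shows "domination_number (weak_zero_divisor_difference_graph P) = 2"
  unfolding domination_number_def
proof (rule Least_equality)
  have "0 < length Fs"
    using n by linarith
  \<comment> \<open>They differ at coordinate 0, so the dominating set really has two
    elements.\<close>
  then have "idem (- {0}) \<noteq> idem (- {1})"
    using vanishes_idem[of 0 "- {0}"] vanishes_idem[of 0 "- {1}"] by auto
  then show "\<exists>S. dominating_set (weak_zero_divisor_difference_graph P) S \<and> finite S \<and> card S = 2"
    using dominating_set_idem[OF n] by (intro exI[of _ "{idem (- {0}), idem (- {1})}"]) simp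
next
  fix m
  assume "\<exists>S. dominating_set (weak_zero_divisor_difference_graph P) S \<and> finite S \<and> card S = m"
  then obtain S where S: "dominating_set (weak_zero_divisor_difference_graph P) S" "finite S" "card S = m"
    by blast
  \<comment> \<open>The graph has a vertex, which rules out the empty dominating set.\<close>
  have "idem (- {0}) \<in> pverts (weak_zero_divisor_difference_graph P)"
    using dominating_set_idem[OF n] by (simp add: dominating_set_def)
  with S(1) have "S \<noteq> {}"
    by (auto simp: dominating_set_def)
  with S(2,3) have "m \<noteq> 0"
    by auto
  moreover have "m \<noteq> 1"
    using S not_dominating_singleton[OF n] by (metis card_1_singletonE)
  ultimately show "2 \<le> m"
    by linarith
qed

end

theorem theorem7p5:
  fixes Fs :: "('a, 'm) ring_scheme list"
  assumes "length Fs \<ge> 3"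
    and "\<And>F. F \<in> set Fs \<Longrightarrow> field F"
    and "\<And>F. F \<in> set Fs \<Longrightarrow> finite (carrier F)"
  shows "domination_number (weak_zero_divisor_difference_graph (RDirProd_list Fs)) = 2"
proof -
  interpret domain_product Fs
    using assms(2) by (simp add: domain_product_def field.axioms(1))
  show ?thesis
    using assms(1) by (rule domination_number_difference_graph)
qed

end
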